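(* For all integers $n\ge 3$ and $m\ge 2$, one has $H_1(n,m)\le (m-1)\cdot m^{n-2}$.
   Context: Consider the perturbed system (first order in $\varepsilon$) $$\dot{x}_1=a_1\varepsilon x_1-(b+b_1\varepsilon)x_2+\sum_{i_1+\cdots+i_n=m}p_{1,i_1,\ldots,i_n,0}\,x_1^{i_1}\cdots x_n^{i_n},$$ $$\dot{x}_2=(b+b_1\varepsilon)x_1+a_1\varepsilon x_2+\sum_{i_1+\cdots+i_n=m}p_{2,i_1,\ldots,i_n,0}\,x_1^{i_1}\cdots x_n^{i_n},$$ $$\dot{x}_s=c_{s,1}\varepsilon x_s+\sum_{i_1+\cdots+i_n=m}p_{s,i_1,\ldots,i_n,0}\,x_1^{i_1}\cdots x_n^{i_n},\quad s=3,\ldots,n,$$ with real parameters $a_1,b_1,b\neq0,c_{s,1},p_{s,i_1,\ldots,i_n,0}$. After $x_1=r\cos\theta$, $x_2=r\sin\theta$ ($r>0$), taking $\theta$ as independent variable and $(r,x_3,\ldots,x_n)=\varepsilon^{1/(m-1)}(R,X_3,\ldots,X_n)$, it becomes $dR/d\theta=\varepsilon F_1+\mathcal{O}(\varepsilon^2)$, $dX_s/d\theta=\varepsilon F_s+\mathcal{O}(\varepsilon^2)$, $s=3,\ldots,n$, with (sums over $i_1+\cdots+i_n=m$) $$F_1=\tfrac1b\Big(a_1R+\sum(p_{1,i_1,\ldots,i_n,0}\cos\theta+p_{2,i_1,\ldots,i_n,0}\sin\theta)(R\cos\theta)^{i_1}(R\sin\theta)^{i_2}X_3^{i_3}\cdots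 X_n^{i_n}\Big),$$ $$F_s=\tfrac1b\Big(c_{s,1}X_s+\sum p_{s,i_1,\ldots,i_n,0}(R\cos\theta)^{i_1}(R\sin\theta)^{i_2}X_3^{i_3}\cdots X_n^{i_n}\Big).$$ With $\boldsymbol{\eta}=(R,X_3,\ldots,X_n)$, the first-order averaged function is $\boldsymbol{f}_1=(f_{1,1},f_{1,3},\ldots,f_{1,n})$, $f_{1,s}(\boldsymbol{\eta})=\int_0^{2\pi}F_s(\theta,\boldsymbol{\eta})\,d\theta$ for $s=1,3,\ldots,n$. $H_1(n,m)$ denotes the maximum number of limit cycles bifurcating from the origin that can be detected by the first-order averaging method, i.e. the maximum, over all real parameter values with $b\ne0$ and $\boldsymbol{f}_1\not\equiv0$, of the number of simple real zeros of $\boldsymbol{f}_1$ with $R>0$ (zeros at which $\det J_{\boldsymbol{f}_1}\neq 0$). Each such zero yields, for $\varepsilon>0$ small, a limit cycle by the averaging theorem. *)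

theory Defs
  imports
    "HOL-Analysis.Analysis"
    "HOL-Library.Extended_Nat"
    "Jordan_Normal_Form.Determinant"
begin

text \<open>
  Points and vector-valued functions are indexed by natural numbers.  A point
  \<open>\<eta> = (R, X\<^sub>3, \<dots>, X\<^sub>n)\<close> is a function \<open>\<eta> :: nat \<Rightarrow> real\<close> with \<open>\<eta> 1 = R\<close> and
  \<open>\<eta> s = X\<^sub>s\<close> for \<open>3 \<le> s \<le> n\<close>; the index 2 is skipped because the second
  coordinate has been replaced by the angle.
\<close>

definition avg_index :: "nat \<Rightarrow> nat set" where
  "avg_index n = insert 1 {3..n}"

definition multi_index :: "nat \<Rightarrow> nat \<Rightarrow> (nat \<Rightarrow> nat) set" where
  "multi_index n m = {i. (\<forall>k. k \<notin> {1..n} \<longrightarrow> i k = 0) \<and> (\<Sum>k=1..n. i k) = m}"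

definition cylindrical :: "real \<Rightarrow> (nat \<Rightarrow> real) \<Rightarrow> nat \<Rightarrow> real" where
  "cylindrical \<theta> \<eta> = \<eta>(1 := \<eta> 1 * cos \<theta>, 2 := \<eta> 1 * sin \<theta>)"

definition monomial_at :: "nat \<Rightarrow> (nat \<Rightarrow> nat) \<Rightarrow> (nat \<Rightarrow> real) \<Rightarrow> real" where
  "monomial_at n i x = (\<Prod>k=1..n. x k ^ i k)"

text \<open>
  The first-order terms in \<open>\<epsilon>\<close> of the rescaled system \<open>dR/d\<theta>\<close>, \<open>dX\<^sub>s/d\<theta>\<close> that comes
  from the perturbed system
  \<open>x\<^sub>1' = a\<^sub>1 \<epsilon> x\<^sub>1 - (b + b\<^sub>1 \<epsilon>) x\<^sub>2 + \<Sum>\<^sub>i p 1 i x\<^sup>i\<close>,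
  \<open>x\<^sub>2' = (b + b\<^sub>1 \<epsilon>) x\<^sub>1 + a\<^sub>1 \<epsilon> x\<^sub>2 + \<Sum>\<^sub>i p 2 i x\<^sup>i\<close>,
  \<open>x\<^sub>s' = c s \<epsilon> x\<^sub>s + \<Sum>\<^sub>i p s i x\<^sup>i\<close> for \<open>3 \<le> s \<le> n\<close>, with \<open>i\<close> ranging over
  \<open>multi_index n m\<close>.  They do not involve the parameter \<open>b\<^sub>1\<close>.
\<close>

definition first_order_term ::
  "nat \<Rightarrow> nat \<Rightarrow> real \<Rightarrow> real \<Rightarrow> (nat \<Rightarrow> real) \<Rightarrow> (nat \<Rightarrow> (nat \<Rightarrow> nat) \<Rightarrow> real)
    \<Rightarrow> nat \<Rightarrow> real \<Rightarrow> (nat \<Rightarrow> real) \<Rightarrow> real" where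
  "first_order_term n m a1 b c p s \<theta> \<eta> =
    (if s = 1 then
       1 / b * (a1 * \<eta> 1 + (\<Sum>i\<in>multi_index n m.
         (p 1 i * cos \<theta> + p 2 i * sin \<theta>) * monomial_at n i (cylindrical \<theta> \<eta>)))
     else
       1 / b * (c s * \<eta> s + (\<Sum>i\<in>multi_index n m.
         p s i * monomial_at n i (cylindrical \<theta> \<eta>))))"

definition averaged_function ::
  "nat \<Rightarrow> nat \<Rightarrow> real \<Rightarrow> real \<Rightarrow> (nat \<Rightarrow> real) \<Rightarrow> (nat \<Rightarrow> (nat \<Rightarrow> nat) \<Rightarrow> real)
    \<Rightarrow> nat \<Rightarrow> (nat \<Rightarrow> real) \<Rightarrow> real" where
  "averaged_function n m a1 b c p s \<eta> =
    integral {0..2 * pi} (\<lambda>\<theta>. first_order_term n m a1 b c p s \<theta> \<eta>)"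

text \<open>
  Matrices have rows and columns numbered from 0, so that row (column) 0 belongs to
  the index 1 and row (column) \<open>k > 0\<close> to the index \<open>k + 2\<close>.
\<close>

definition avg_pos :: "nat \<Rightarrow> nat" where
  "avg_pos k = (if k = 0 then 1 else k + 2)"

definition jacobian_matrix ::
  "nat \<Rightarrow> (nat \<Rightarrow> (nat \<Rightarrow> real) \<Rightarrow> real) \<Rightarrow> (nat \<Rightarrow> real) \<Rightarrow> real mat" where
  "jacobian_matrix n f \<eta> = Matrix.mat (n - 1) (n - 1)
    (\<lambda>(k, l). deriv (\<lambda>t. f (avg_pos k) (\<eta>(avg_pos l := t))) (\<eta> (avg_pos l)))"

text \<open>
  Coordinates outside \<open>avg_index n\<close> are required to vanish, so that distinct elements
  of the following set are distinct points of \<open>\<real>\<^sup>n\<^sup>-\<^sup>1\<close>.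
\<close>

definition simple_zeros ::
  "nat \<Rightarrow> (nat \<Rightarrow> (nat \<Rightarrow> real) \<Rightarrow> real) \<Rightarrow> (nat \<Rightarrow> real) set" where
  "simple_zeros n f = {\<eta>. (\<forall>k. k \<notin> avg_index n \<longrightarrow> \<eta> k = 0) \<and> \<eta> 1 > 0 \<and>
    (\<forall>s\<in>avg_index n. f s \<eta> = 0) \<and> Determinant.det (jacobian_matrix n f \<eta>) \<noteq> 0}"

definition number_of :: "'a set \<Rightarrow> enat" where
  "number_of A = (if finite A then enat (card A) else \<infinity>)"

definition H1 :: "nat \<Rightarrow> nat \<Rightarrow> enat" where
  "H1 n m = Sup {number_of (simple_zeros n (averaged_function n m a1 b c p)) | a1 b c p.
    b \<noteq> 0 \<and> (\<exists>s\<in>avg_index n. \<exists>\<eta>. averaged_function n m a1 b c p s \<eta> \<noteq> 0)}"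

end

theory Submission
  imports Defs "Jordan_Normal_Form.Char_Poly" "HOL-Computational_Algebra.Polynomial_FPS"
begin

text \<open>
  A monomial enters the integral defining \<open>f\<^sub>1\<^sub>,\<^sub>1\<close> with a factor \<open>R\<close> unless
  \<open>i\<^sub>1 = i\<^sub>2 = 0\<close>, and in that case its mean over the angle vanishes.  So \<open>f\<^sub>1\<^sub>,\<^sub>1 = R g\<close>
  with \<open>deg g \<le> m - 1\<close>, and the simple zeros with \<open>R > 0\<close> are nondegenerate zeros of \<open>g\<close>
  together with \<open>n - 2\<close> polynomials of degree \<open>\<le> m\<close>.  The bound is the Bezout inequality for
  nondegenerate zeros.

  For the Bezout inequality, deform \<open>f\<^sub>s\<close> of degree \<open>\<le> d\<^sub>s\<close> to
  \<open>F\<^sub>s = f\<^sub>s + \<tau> x\<^sub>s^d\<^sub>s\<close> over the power series ring in \<open>\<tau>\<close>.  Each nondegenerate zero \<open>z\<close> of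
  \<open>f\<close> lifts to a power series zero of \<open>F\<close> by Hensel's lemma.  On the zeros of \<open>F\<close>, the
  vector \<open>v\<close> of all monomials of degree \<open>\<le> D\<close> satisfies \<open>(\<tau> - B) v = \<tau> w\<close>, where \<open>B\<close> is a
  real matrix and \<open>w\<close> contains only the reduced monomials (those with \<open>a\<^sub>s < d\<^sub>s\<close> for all
  \<open>s\<close>).  Since \<open>det (\<tau> - B)\<close> is a characteristic polynomial, hence nonzero, the \<open>\<Prod> d\<^sub>s\<close>
  reduced monomials span all functions on the lifted zeros that are given by polynomials of
  degree \<open>\<le> D\<close>.  These include Lagrange polynomials, which separate the lifted zeros, so there
  are at most \<open>\<Prod> d\<^sub>s\<close> zeros.
\<close>

section \<open>Linear algebra over power series\<close>

lemma comm_ring_hom_fps_of_poly: "comm_ring_hom (fps_of_poly :: real poly \<Rightarrow> real fps)"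
  by unfold_locales (auto simp: fps_of_poly_add fps_of_poly_mult)

lemma comm_ring_hom_fps_nth_0: "comm_ring_hom (\<lambda>f :: real fps. fps_nth f 0)"
  by unfold_locales auto

text \<open>The matrix is the image of the characteristic matrix of \<open>B\<close> under the
  embedding of polynomials into power series, so its determinant is the image of a monic
  polynomial.\<close>

lemma det_X_minus_const_nonzero:
  fixes B :: "nat \<Rightarrow> nat \<Rightarrow> real"
  shows "Determinant.det (Matrix.mat q q (\<lambda>(i, j). (if i = j then fps_X else 0) - fps_const (B i j))) \<noteq> 0"
    (is "Determinant.det ?M \<noteq> 0")
proof -
  interpret h: comm_ring_hom "fps_of_poly :: real poly \<Rightarrow> real fps"
    by (rule comm_ring_hom_fps_of_poly)
  define Bm where "Bm = Matrix.mat q q (\<lambda>(i, j). B i j)"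
  have Bm: "Bm \<in> carrier_mat q q" by (simp add: Bm_def)
  have "?M = map_mat fps_of_poly (char_poly_matrix Bm)"
    by (rule eq_matI)
      (auto simp: char_poly_matrix_def Bm_def fps_of_poly_add fps_of_poly_pCons fps_of_poly_diff)
  then have "Determinant.det ?M = fps_of_poly (char_poly Bm)"
    by (simp add: char_poly_def)
  moreover have "char_poly Bm \<noteq> 0"
    using degree_monic_char_poly[OF Bm] by auto
  ultimately show ?thesis
    by simp
qed

text \<open>The relations read \<open>M v = fps_X w\<close>, where \<open>w\<close> is
  \<open>v\<close> cut down to \<open>R\<close>; multiplying by the adjugate of \<open>M\<close>
  leaves \<open>\<delta> v\<close> with \<open>\<delta> = det M\<close>. As \<open>M\<close> depends
  only on \<open>B\<close>, the same \<open>\<delta>\<close> and \<open>C\<close> serve every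
  solution \<open>v\<close>.\<close>

lemma span_by_char_poly:
  fixes B :: "'a \<Rightarrow> 'a \<Rightarrow> real"
  assumes A: "finite A" and RA: "R \<subseteq> A"
  shows "\<exists>\<delta> C. \<delta> \<noteq> 0 \<and> (\<forall>v :: 'a \<Rightarrow> real fps.
    (\<forall>a\<in>A - R. fps_X * v a = (\<Sum>b\<in>A. fps_const (B a b) * v b)) \<longrightarrow>
    (\<forall>a\<in>A. \<delta> * v a = (\<Sum>r\<in>R. C a r * v r)))"
proof -
  define q where "q = card A"
  obtain e where e: "bij_betw e {0..<q} A"
    using ex_bij_betw_nat_finite[OF A] q_def by auto
  \<comment> \<open>Zero rows for the indices in \<open>R\<close> turn these rows of
    \<open>M v = fps_X w\<close> into identities, so the system becomes square although no relation
    is given there.\<close>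
  define B' where "B' = (\<lambda>i j. if e i \<in> R then 0 else B (e i) (e j))"
  define M where "M = Matrix.mat q q (\<lambda>(i, j). (if i = j then fps_X else 0) - fps_const (B' i j))"
  define \<delta> where "\<delta> = Determinant.det M"
  define N where "N = adj_mat M"
  have M: "M \<in> carrier_mat q q" by (simp add: M_def)
  have N: "N \<in> carrier_mat q q" and NM: "N * M = \<delta> \<cdot>\<^sub>m 1\<^sub>m q"
    using adj_mat[OF M] by (auto simp: N_def \<delta>_def)
  have entry: "(\<Sum>k=0..<q. N $$ (i, k) * M $$ (k, j)) = (if i = j then \<delta> else 0)"
    if "i < q" "j < q" for i j
  proof -
    have "(N * M) $$ (i, j) = (\<Sum>k=0..<q. N $$ (i, k) * M $$ (k, j))"
      using that M N by (auto simp: scalar_prod_def)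
    with NM that show ?thesis by auto
  qed
  define g where "g = inv_into {0..<q} e"
  have g: "g a < q" "e (g a) = a" if "a \<in> A" for a
    using that e bij_betw_inv_into_right[OF e that] bij_betw_apply[OF bij_betw_inv_into[OF e] that]
    by (auto simp: g_def)
  have ge: "g (e k) = k" if "k < q" for k
    using that e by (auto simp: g_def bij_betw_inv_into_left)
  define C where "C = (\<lambda>a r. N $$ (g a, g r) * fps_X)"
  have "\<delta> * v a = (\<Sum>r\<in>R. C a r * v r)"
    if v: "\<forall>a\<in>A - R. fps_X * v a = (\<Sum>b\<in>A. fps_const (B a b) * v b)" and a: "a \<in> A"
    for v :: "'a \<Rightarrow> real fps" and a
  proof -
    have row: "(\<Sum>j=0..<q. M $$ (k, j) * v (e j)) = (if e k \<in> R then fps_X * v (e k) else 0)"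
      if k: "k < q" for k
    proof -
      have "(\<Sum>j=0..<q. M $$ (k, j) * v (e j)) =
          (\<Sum>j=0..<q. (if k = j then fps_X * v (e j) else 0)) - (\<Sum>j=0..<q. fps_const (B' k j) * v (e j))"
        unfolding sum_subtractf[symmetric]
        using k by (intro sum.cong) (auto simp: M_def left_diff_distrib)
      also have "(\<Sum>j=0..<q. fps_const (B' k j) * v (e j)) = (if e k \<in> R then 0 else fps_X * v (e k))"
      proof (cases "e k \<in> R")
        case False
        then have "(\<Sum>j=0..<q. fps_const (B' k j) * v (e j)) = (\<Sum>b\<in>A. fps_const (B (e k) b) * v b)"
          by (simp add: B'_def sum.reindex_bij_betw[OF e, where g = "\<lambda>b. fps_const (B (e k) b) * v b"])
        then show ?thesis
          using v False bij_betw_apply[OF e, of k] k by auto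
      qed (simp add: B'_def)
      finally show ?thesis using k by auto
    qed
    have "\<delta> * v a = (\<Sum>j=0..<q. (if g a = j then \<delta> else 0) * v (e j))"
      using g[OF a] by (simp add: if_distrib[of "\<lambda>x. x * _"] cong: if_cong)
    also have "\<dots> = (\<Sum>j=0..<q. (\<Sum>k=0..<q. N $$ (g a, k) * M $$ (k, j)) * v (e j))"
      using entry g[OF a] by (intro sum.cong) auto
    also have "\<dots> = (\<Sum>k=0..<q. N $$ (g a, k) * (\<Sum>j=0..<q. M $$ (k, j) * v (e j)))"
      unfolding sum_distrib_left sum_distrib_right by (subst sum.swap) (simp add: mult.assoc)
    also have "\<dots> = (\<Sum>k=0..<q. if e k \<in> R then C a (e k) * v (e k) else 0)"
      using row by (intro sum.cong) (auto simp: C_def ge)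
    also have "\<dots> = (\<Sum>r\<in>A. if r \<in> R then C a r * v r else 0)"
      by (rule sum.reindex_bij_betw[OF e])
    also have "\<dots> = (\<Sum>r\<in>R. C a r * v r)"
      using A RA by (simp add: sum.inter_restrict[symmetric] Int_absorb1)
    finally show ?thesis .
  qed
  moreover have "\<delta> \<noteq> 0"
    unfolding \<delta>_def M_def by (rule det_X_minus_const_nonzero)
  ultimately show ?thesis by blast
qed

text \<open>Modulo \<open>fps_X\<close> the matrix \<open>L\<close> is diagonal and invertible, so
  its determinant is nonzero, whereas a product through fewer than \<open>k\<close> indices is
  singular.\<close>

lemma card_le_of_factorization:
  fixes L :: "nat \<Rightarrow> nat \<Rightarrow> real fps"
  assumes diag: "\<And>i. i < k \<Longrightarrow> fps_nth (L i i) 0 \<noteq> 0"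
    and off: "\<And>i j. i < k \<Longrightarrow> j < k \<Longrightarrow> i \<noteq> j \<Longrightarrow> fps_nth (L i j) 0 = 0"
    and \<delta>: "\<delta> \<noteq> 0"
    and fac: "\<And>i j. i < k \<Longrightarrow> j < k \<Longrightarrow> \<delta> * L i j = (\<Sum>r\<in>R. C i r * E r j)"
    and R: "finite R"
  shows "k \<le> card R"
proof (rule ccontr)
  assume "\<not> k \<le> card R"
  then have lt: "card R < k" by simp
  interpret h: comm_ring_hom "\<lambda>f :: real fps. fps_nth f 0"
    by (rule comm_ring_hom_fps_nth_0)
  obtain e where e: "bij_betw e {0..<card R} R"
    using ex_bij_betw_nat_finite[OF R] by auto
  define Lm where "Lm = Matrix.mat k k (\<lambda>(i, j). L i j)"
  \<comment> \<open>Zero columns of \<open>Cm\<close> and zero rows of \<open>Em\<close> pad the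
    factors to square matrices; row \<open>card R\<close> of \<open>Em\<close> exists and is zero
    because \<open>card R < k\<close>.\<close>
  define Cm where "Cm = Matrix.mat k k (\<lambda>(i, j). if j < card R then C i (e j) else 0)"
  define Em where "Em = Matrix.mat k k (\<lambda>(i, j). if i < card R then E (e i) j else 0)"
  have car: "Lm \<in> carrier_mat k k" "Cm \<in> carrier_mat k k" "Em \<in> carrier_mat k k"
    by (auto simp: Lm_def Cm_def Em_def)
  have "\<delta> \<cdot>\<^sub>m Lm = Cm * Em"
  proof (rule eq_matI)
    fix i j assume "i < dim_row (Cm * Em)" "j < dim_col (Cm * Em)"
    then have ij: "i < k" "j < k" by (auto simp: Cm_def Em_def)
    have "(Cm * Em) $$ (i, j) = (\<Sum>l=0..<k. if l < card R then C i (e l) * E (e l) j else 0)"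
      using ij by (auto simp: Cm_def Em_def scalar_prod_def intro!: sum.cong)
    also have "\<dots> = (\<Sum>l=0..<card R. C i (e l) * E (e l) j)"
      using lt by (intro sum.mono_neutral_cong_right) auto
    also have "\<dots> = (\<Sum>r\<in>R. C i r * E r j)"
      by (rule sum.reindex_bij_betw[OF e])
    finally show "(\<delta> \<cdot>\<^sub>m Lm) $$ (i, j) = (Cm * Em) $$ (i, j)"
      using fac ij by (simp add: Lm_def)
  qed (auto simp: Lm_def Cm_def Em_def)
  then have eq: "\<delta> ^ k * Determinant.det Lm = Determinant.det Cm * Determinant.det Em"
    using det_mult[OF car(2,3)] car by (metis det_smult carrier_matD(2))
  have "fps_nth (Determinant.det Lm) 0 = Determinant.det (map_mat (\<lambda>f. fps_nth f 0) Lm)"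
    by (rule h.hom_det[symmetric])
  also have "\<dots> = prod_list (diag_mat (map_mat (\<lambda>f. fps_nth f 0) Lm))"
    by (rule det_upper_triangular[of _ k]) (auto simp: Lm_def off)
  also have "\<dots> \<noteq> 0"
    using diag by (auto simp: diag_mat_def Lm_def prod_list_zero_iff)
  finally have "Determinant.det Lm \<noteq> 0" by auto
  moreover have "Determinant.det Em = 0"
  proof -
    have "Determinant.det Em = (\<Sum>j<k. Em $$ (card R, j) * cofactor Em (card R) j)"
      by (rule laplace_expansion_row[OF car(3) lt])
    also have "\<dots> = 0"
      using lt by (intro sum.neutral) (auto simp: Em_def)
    finally show ?thesis .
  qed
  ultimately show False using eq \<delta> by simp
qed

section \<open>Polynomial functions and lifting of zeros\<close>

definition exps :: "'i set \<Rightarrow> nat \<Rightarrow> ('i \<Rightarrow> nat) set" where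
  "exps I d = {a. (\<forall>k. k \<notin> I \<longrightarrow> a k = 0) \<and> sum a I \<le> d}"

text \<open>The ring is arbitrary because the same monomials are evaluated at real points and at
  tuples of power series.\<close>

definition monom_eval :: "'i set \<Rightarrow> ('i \<Rightarrow> nat) \<Rightarrow> ('i \<Rightarrow> 'a) \<Rightarrow> 'a :: comm_ring_1" where
  "monom_eval I a x = (\<Prod>k\<in>I. x k ^ a k)"

definition poly_funs :: "'i set \<Rightarrow> nat \<Rightarrow> (('i \<Rightarrow> 'a) \<Rightarrow> 'a :: comm_ring_1) set" where
  "poly_funs I d = {f. \<exists>c. \<forall>x. f x = (\<Sum>a\<in>exps I d. c a * monom_eval I a x)}"

lemma finite_exps:
  assumes "finite I"
  shows "finite (exps I d)"
proof (rule finite_subset)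
  show "exps I d \<subseteq> {a. \<forall>k. (k \<in> I \<longrightarrow> a k \<in> {0..d}) \<and> (k \<notin> I \<longrightarrow> a k = 0)}"
  proof (intro subsetI CollectI allI conjI impI)
    fix a k assume a: "a \<in> exps I d"
    show "a k \<in> {0..d}" if "k \<in> I"
      using member_le_sum[of k I a] a assms that by (simp add: exps_def)
    show "a k = 0" if "k \<notin> I"
      using a that by (simp add: exps_def)
  qed
  show "finite {a :: 'a \<Rightarrow> nat. \<forall>k. (k \<in> I \<longrightarrow> a k \<in> {0..d}) \<and> (k \<notin> I \<longrightarrow> a k = 0)}"
    using assms by (intro finite_set_of_finite_funs) auto
qed

lemma monom_eval_add:
  "monom_eval I (\<lambda>k. a k + b k) x = monom_eval I a x * monom_eval I b x"
  by (simp add: monom_eval_def power_add prod.distrib)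

lemma monom_eval_single:
  assumes "finite I" "s \<in> I"
  shows "monom_eval I (\<lambda>k. if k = s then d else 0) x = x s ^ d"
  using assms by (simp add: monom_eval_def if_distrib[of "\<lambda>e. _ ^ e"] prod.delta cong: if_cong)

lemma poly_funs_monom:
  assumes "finite I" "a \<in> exps I d"
  shows "monom_eval I a \<in> poly_funs I d"
  unfolding poly_funs_def
  by (intro CollectI exI[of _ "\<lambda>b. if b = a then 1 else 0"])
    (use assms finite_exps[OF assms(1)] in \<open>simp add: if_distrib[of "\<lambda>e. e * _"] cong: if_cong\<close>)

lemma poly_funs_add:
  assumes "f \<in> poly_funs I d" "g \<in> poly_funs I d"
  shows "(\<lambda>x. f x + g x) \<in> poly_funs I d"
proof -
  obtain c e where "\<And>x. f x = (\<Sum>a\<in>exps I d. c a * monom_eval I a x)"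
    "\<And>x. g x = (\<Sum>a\<in>exps I d. e a * monom_eval I a x)"
    using assms by (auto simp: poly_funs_def)
  then show ?thesis
    unfolding poly_funs_def
    by (intro CollectI exI[of _ "\<lambda>a. c a + e a"]) (simp add: sum.distrib distrib_right)
qed

lemma poly_funs_cmult:
  assumes "f \<in> poly_funs I d"
  shows "(\<lambda>x. q * f x) \<in> poly_funs I d"
proof -
  obtain c where "\<And>x. f x = (\<Sum>a\<in>exps I d. c a * monom_eval I a x)"
    using assms by (auto simp: poly_funs_def)
  then show ?thesis
    unfolding poly_funs_def
    by (intro CollectI exI[of _ "\<lambda>a. q * c a"]) (simp add: sum_distrib_left mult.assoc)
qed

lemma poly_funs_sum:
  assumes "\<And>j. j \<in> J \<Longrightarrow> f j \<in> poly_funs I d"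
  shows "(\<lambda>x. \<Sum>j\<in>J. f j x) \<in> poly_funs I d"
proof (cases "finite J")
  case True
  then show ?thesis using assms
  proof (induction J)
    case empty
    show ?case by (auto simp: poly_funs_def intro!: exI[of _ "\<lambda>_. 0"])
  next
    case (insert j J)
    then show ?case by (simp add: poly_funs_add)
  qed
qed (auto simp: poly_funs_def intro!: exI[of _ "\<lambda>_. 0"])

lemma poly_funs_times_var:
  assumes I: "finite I" "l \<in> I" and f: "f \<in> poly_funs I d" and dd: "d < d'"
  shows "(\<lambda>x. x l * f x) \<in> poly_funs I d'"
proof -
  obtain c where c: "\<And>x. f x = (\<Sum>a\<in>exps I d. c a * monom_eval I a x)"
    using f by (auto simp: poly_funs_def)
  let ?up = "\<lambda>a k. a k + (if k = l then 1 else 0 :: nat)"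
  have "(\<lambda>x. x l * f x) = (\<lambda>x. \<Sum>a\<in>exps I d. c a * monom_eval I (?up a) x)"
    unfolding c monom_eval_add monom_eval_single[OF I] by (auto simp: sum_distrib_left ac_simps)
  also have "\<dots> \<in> poly_funs I d'"
    using I dd
    by (intro poly_funs_sum poly_funs_cmult poly_funs_monom)
      (auto simp: exps_def sum.distrib)
  finally show ?thesis .
qed

lemma poly_funs_mono:
  assumes I: "finite I" and f: "f \<in> poly_funs I d" and dd: "d \<le> d'"
  shows "f \<in> poly_funs I d'"
proof -
  obtain c where c: "\<And>x. f x = (\<Sum>a\<in>exps I d. c a * monom_eval I a x)"
    using f by (auto simp: poly_funs_def)
  then have "f = (\<lambda>x. \<Sum>a\<in>exps I d. c a * monom_eval I a x)" by auto
  also have "\<dots> \<in> poly_funs I d'"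
    using I dd by (intro poly_funs_sum poly_funs_cmult poly_funs_monom) (auto simp: exps_def)
  finally show ?thesis .
qed

text \<open>Lagrange polynomials in several variables have this shape: each factor may use a
  coordinate of its own.\<close>

lemma poly_funs_prod_linear:
  assumes I: "finite I" and T: "finite T" and l: "\<And>i. i \<in> T \<Longrightarrow> l i \<in> I"
  shows "(\<lambda>x. \<Prod>i\<in>T. x (l i) - c i) \<in> poly_funs I (card T)"
  using T l
proof (induction T)
  case empty
  have "monom_eval I (\<lambda>_. 0) \<in> poly_funs I 0"
    using I by (intro poly_funs_monom) (auto simp: exps_def)
  then show ?case by (simp add: monom_eval_def[abs_def])
next
  case (insert i T)
  let ?f = "\<lambda>x. \<Prod>i\<in>T. x (l i) - c i"
  have f: "?f \<in> poly_funs I (card T)" using insert by auto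
  have "(\<lambda>x. x (l i) * ?f x + (- c i) * ?f x) \<in> poly_funs I (Suc (card T))"
    using insert by (intro poly_funs_add poly_funs_times_var[OF I _ f]
        poly_funs_cmult poly_funs_mono[OF I f]) auto
  moreover have "(\<lambda>x. \<Prod>i\<in>insert i T. x (l i) - c i) = (\<lambda>x. x (l i) * ?f x + (- c i) * ?f x)"
    using insert by (auto simp: algebra_simps)
  ultimately show ?case using insert by simp
qed

text \<open>A monomial that is not reduced contains \<open>x s ^ d s\<close> for some
  \<open>s\<close>. Multiplied by \<open>fps_X\<close>, this power may be replaced by minus the
  polynomial with coefficients \<open>c s\<close>, which gives a real combination of monomials of
  degree at most \<open>D\<close>. These are the relations that \<open>span_by_char_poly\<close>
  expects, with coefficients independent of \<open>X\<close>.\<close>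

lemma reduced_monomials_span:
  fixes c :: "'i \<Rightarrow> ('i \<Rightarrow> nat) \<Rightarrow> real" and d :: "'i \<Rightarrow> nat" and D :: nat
  assumes I: "finite I"
  defines "R \<equiv> {a \<in> exps I D. \<forall>i\<in>I. a i < d i}"
  shows "\<exists>\<delta> C. \<delta> \<noteq> 0 \<and> (\<forall>X :: 'i \<Rightarrow> real fps.
    (\<forall>s\<in>I. (\<Sum>a\<in>exps I (d s). fps_const (c s a) * monom_eval I a X) + fps_X * X s ^ d s = 0) \<longrightarrow>
    (\<forall>a\<in>exps I D. \<delta> * monom_eval I a X = (\<Sum>r\<in>R. C a r * monom_eval I r X)))"
proof -
  \<comment> \<open>For a non-reduced \<open>a\<close>, this picks a variable whose exponent is too
    large; \<open>sh a\<close> below is the exponent of the cofactor of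
    \<open>x (s a) ^ d (s a)\<close>.\<close>
  define s where "s = (\<lambda>a :: 'i \<Rightarrow> nat. SOME i. i \<in> I \<and> d i \<le> a i)"
  have s: "s a \<in> I" "d (s a) \<le> a (s a)" if "a \<in> exps I D - R" for a
  proof -
    have "\<exists>i. i \<in> I \<and> d i \<le> a i" using that by (force simp: R_def)
    from someI_ex[OF this] show "s a \<in> I" "d (s a) \<le> a (s a)" by (auto simp: s_def)
  qed
  define sh where "sh = (\<lambda>a :: 'i \<Rightarrow> nat. a(s a := a (s a) - d (s a)))"
  define sg where "sg = (\<lambda>a e k :: 'i. sh a k + e k :: nat)"
  \<comment> \<open>\<open>B a b\<close> is the coefficient of the monomial \<open>b\<close> in
    minus the product of the monomial \<open>sh a\<close> with the polynomial given by
    \<open>c (s a)\<close>.\<close>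
  define B where "B = (\<lambda>a b. - (\<Sum>e\<in>{e \<in> exps I (d (s a)). sg a e = b}. c (s a) e))"
  have sh: "a = (\<lambda>k. sh a k + (if k = s a then d (s a) else 0))" if "a \<in> exps I D - R" for a
    using s[OF that] by (auto simp: sh_def)
  \<comment> \<open>Removing the power lowers the degree by \<open>d (s a)\<close>, and
    \<open>e\<close> adds at most as much, so the monomials of degree at most \<open>D\<close> are
    not left.\<close>
  have sg: "sg a e \<in> exps I D" if a: "a \<in> exps I D - R" and e: "e \<in> exps I (d (s a))" for a e
  proof -
    have "sum a I = sum (sh a) I + d (s a)"
      by (subst sh[OF a]) (use s[OF a] I in \<open>simp add: sum.distrib\<close>)
    then show ?thesis
      using a e s[OF a] by (auto simp: exps_def sg_def sh_def sum.distrib)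
  qed
  have eq: "fps_X * monom_eval I a X = (\<Sum>b\<in>exps I D. fps_const (B a b) * monom_eval I b X)"
    if X: "\<forall>s\<in>I. (\<Sum>a\<in>exps I (d s). fps_const (c s a) * monom_eval I a X) + fps_X * X s ^ d s = 0"
      and a: "a \<in> exps I D - R" for X a
  proof -
    let ?E = "exps I (d (s a))"
    have X': "fps_X * X (s a) ^ d (s a) = - (\<Sum>e\<in>?E. fps_const (c (s a) e) * monom_eval I e X)"
      using X s(1)[OF a] by (simp add: eq_neg_iff_add_eq_0 add.commute)
    have "fps_X * monom_eval I a X = monom_eval I (sh a) X * (fps_X * X (s a) ^ d (s a))"
      by (subst sh[OF a]) (simp add: monom_eval_add monom_eval_single[OF I s(1)[OF a]])
    also have "\<dots> = (\<Sum>e\<in>?E. - fps_const (c (s a) e) * monom_eval I (sg a e) X)"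
      unfolding X' sg_def monom_eval_add by (simp add: sum_distrib_left sum_negf ac_simps del: fps_const_neg)
    also have "\<dots> = (\<Sum>b\<in>exps I D. \<Sum>e\<in>{e \<in> ?E. sg a e = b}. - fps_const (c (s a) e) * monom_eval I (sg a e) X)"
      using sg[OF a] by (intro sum.group[symmetric] finite_exps I) auto
    also have "\<dots> = (\<Sum>b\<in>exps I D. fps_const (B a b) * monom_eval I b X)"
    proof (rule sum.cong)
      fix b assume "b \<in> exps I D"
      have "fps_const (B a b) = (\<Sum>e\<in>{e \<in> ?E. sg a e = b}. - fps_const (c (s a) e))"
        by (rule fps_ext) (auto simp: B_def fps_sum_nth sum_negf)
      then show "(\<Sum>e\<in>{e \<in> ?E. sg a e = b}. - fps_const (c (s a) e) * monom_eval I (sg a e) X) =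
          fps_const (B a b) * monom_eval I b X"
        by (simp add: sum_distrib_right)
    qed simp
    finally show ?thesis .
  qed
  have "R \<subseteq> exps I D" by (auto simp: R_def)
  from span_by_char_poly[OF finite_exps[OF I] this, of B] obtain \<delta> C where "\<delta> \<noteq> 0"
    and *: "\<And>v :: _ \<Rightarrow> real fps. (\<forall>a\<in>exps I D - R. fps_X * v a = (\<Sum>b\<in>exps I D. fps_const (B a b) * v b)) \<Longrightarrow>
    (\<forall>a\<in>exps I D. \<delta> * v a = (\<Sum>r\<in>R. C a r * v r))"
    by blast
  then show ?thesis
    using eq by (intro exI[of _ \<delta>] exI[of _ C]) (auto intro!: *[rule_format])
qed

section \<open>Differentials over power series and Newton iteration\<close>

lemma fps_mult_nth_low:
  fixes A G :: "'a :: comm_ring_1 fps"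
  assumes "\<And>j. j < k \<Longrightarrow> fps_nth G j = 0"
  shows "fps_nth (A * G) k = fps_nth A 0 * fps_nth G k"
proof -
  have "fps_nth (A * G) k = (\<Sum>i=0..k. if i = 0 then fps_nth A 0 * fps_nth G k else 0)"
    unfolding fps_mult_nth using assms by (intro sum.cong) auto
  then show ?thesis by simp
qed

text \<open>
  \<open>F\<close> evaluates \<open>f\<close> on power series with constant terms \<open>z\<close>, and a change of the argument
  that starts in degree \<open>k\<close> changes the \<open>k\<close>-th coefficient of the value by the differential
  \<open>d\<close> of \<open>f\<close> at \<open>z\<close>.  This is all that Newton iteration needs.
\<close>

definition first_order_lift ::
  "'i set \<Rightarrow> ('i \<Rightarrow> real) \<Rightarrow> (('i \<Rightarrow> real fps) \<Rightarrow> real fps) \<Rightarrow> (('i \<Rightarrow> real) \<Rightarrow> real)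
    \<Rightarrow> ('i \<Rightarrow> real) \<Rightarrow> bool" where
  "first_order_lift I z F f d \<longleftrightarrow>
    (\<forall>X. (\<forall>l\<in>I. fps_nth (X l) 0 = z l) \<longrightarrow> fps_nth (F X) 0 = f z) \<and>
    (\<forall>k X Y. (\<forall>l\<in>I. fps_nth (X l) 0 = z l) \<longrightarrow> (\<forall>l\<in>I. fps_nth (Y l) 0 = z l) \<longrightarrow>
      (\<forall>l\<in>I. \<forall>j<k. fps_nth (X l) j = fps_nth (Y l) j) \<longrightarrow>
      (\<forall>j<k. fps_nth (F X) j = fps_nth (F Y) j) \<and>
      fps_nth (F X) k - fps_nth (F Y) k = (\<Sum>l\<in>I. d l * (fps_nth (X l) k - fps_nth (Y l) k))) \<and>
    (\<forall>l\<in>I. ((\<lambda>t. f (z(l := t))) has_real_derivative d l) (at (z l)))"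

lemma first_order_liftD:
  assumes "first_order_lift I z F f d"
  shows "(\<And>l. l \<in> I \<Longrightarrow> fps_nth (X l) 0 = z l) \<Longrightarrow> fps_nth (F X) 0 = f z"
    and "(\<And>l. l \<in> I \<Longrightarrow> fps_nth (X l) 0 = z l) \<Longrightarrow> (\<And>l. l \<in> I \<Longrightarrow> fps_nth (Y l) 0 = z l) \<Longrightarrow>
      (\<And>l j. l \<in> I \<Longrightarrow> j < k \<Longrightarrow> fps_nth (X l) j = fps_nth (Y l) j) \<Longrightarrow> j < k \<Longrightarrow>
      fps_nth (F X) j = fps_nth (F Y) j"
    and "(\<And>l. l \<in> I \<Longrightarrow> fps_nth (X l) 0 = z l) \<Longrightarrow> (\<And>l. l \<in> I \<Longrightarrow> fps_nth (Y l) 0 = z l) \<Longrightarrow>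
      (\<And>l j. l \<in> I \<Longrightarrow> j < k \<Longrightarrow> fps_nth (X l) j = fps_nth (Y l) j) \<Longrightarrow>
      fps_nth (F X) k - fps_nth (F Y) k = (\<Sum>l\<in>I. d l * (fps_nth (X l) k - fps_nth (Y l) k))"
    and "l \<in> I \<Longrightarrow> ((\<lambda>t. f (z(l := t))) has_real_derivative d l) (at (z l))"
proof -
  note c = assms[unfolded first_order_lift_def]
  show "(\<And>l. l \<in> I \<Longrightarrow> fps_nth (X l) 0 = z l) \<Longrightarrow> fps_nth (F X) 0 = f z"
    using c[THEN conjunct1] by blast
  show "fps_nth (F X) j = fps_nth (F Y) j"
    if "\<And>l. l \<in> I \<Longrightarrow> fps_nth (X l) 0 = z l" "\<And>l. l \<in> I \<Longrightarrow> fps_nth (Y l) 0 = z l"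
      "\<And>l j. l \<in> I \<Longrightarrow> j < k \<Longrightarrow> fps_nth (X l) j = fps_nth (Y l) j" "j < k"
    using c[THEN conjunct2, THEN conjunct1, rule_format, of X Y k, THEN conjunct1] that by blast
  show "fps_nth (F X) k - fps_nth (F Y) k = (\<Sum>l\<in>I. d l * (fps_nth (X l) k - fps_nth (Y l) k))"
    if "\<And>l. l \<in> I \<Longrightarrow> fps_nth (X l) 0 = z l" "\<And>l. l \<in> I \<Longrightarrow> fps_nth (Y l) 0 = z l"
      "\<And>l j. l \<in> I \<Longrightarrow> j < k \<Longrightarrow> fps_nth (X l) j = fps_nth (Y l) j"
    using c[THEN conjunct2, THEN conjunct1, rule_format, of X Y k, THEN conjunct2] that by blast
  show "l \<in> I \<Longrightarrow> ((\<lambda>t. f (z(l := t))) has_real_derivative d l) (at (z l))"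
    using c[THEN conjunct2, THEN conjunct2] by blast
qed

lemma first_order_lift_cong:
  assumes "first_order_lift I z F f d" "\<And>l. l \<in> I \<Longrightarrow> d l = e l"
  shows "first_order_lift I z F f e"
proof -
  have eq: "(\<Sum>l\<in>I. e l * g l) = (\<Sum>l\<in>I. d l * g l)" for g
    by (rule sum.cong) (auto simp: assms(2))
  note c = assms(1)[unfolded first_order_lift_def]
  show ?thesis
    unfolding first_order_lift_def eq
  proof (intro conjI ballI c[THEN conjunct1] c[THEN conjunct2, THEN conjunct1])
    show "((\<lambda>t. f (z(l := t))) has_real_derivative e l) (at (z l))" if "l \<in> I" for l
      using first_order_liftD(4)[OF assms(1) that] assms(2)[OF that] by simp
  qed
qed

lemma first_order_lift_const: "first_order_lift I z (\<lambda>_. fps_const c) (\<lambda>_. c) (\<lambda>_. 0)"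
  by (auto simp: first_order_lift_def)

lemma first_order_lift_var:
  assumes "finite I" "s \<in> I"
  shows "first_order_lift I z (\<lambda>X. X s) (\<lambda>x. x s) (\<lambda>l. if l = s then 1 else 0)"
  using assms by (auto simp: first_order_lift_def if_distrib[of "\<lambda>e. e * _"] cong: if_cong)

lemma first_order_lift_add:
  assumes "first_order_lift I z F f d" "first_order_lift I z G g e"
  shows "first_order_lift I z (\<lambda>X. F X + G X) (\<lambda>x. f x + g x) (\<lambda>l. d l + e l)"
  unfolding first_order_lift_def
proof (intro conjI allI ballI impI)
  fix k X Y assume *: "\<forall>l\<in>I. fps_nth (X l) 0 = z l" "\<forall>l\<in>I. fps_nth (Y l) 0 = z l"
    "\<forall>l\<in>I. \<forall>j<k. fps_nth (X l) j = fps_nth (Y l) j"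
  show "fps_nth (F X + G X) j = fps_nth (F Y + G Y) j" if "j < k" for j
    using first_order_liftD(2)[OF assms(1), of X Y k j] first_order_liftD(2)[OF assms(2), of X Y k j] * that
    by auto
  show "fps_nth (F X + G X) k - fps_nth (F Y + G Y) k =
      (\<Sum>l\<in>I. (d l + e l) * (fps_nth (X l) k - fps_nth (Y l) k))"
    using first_order_liftD(3)[OF assms(1), of X Y k] first_order_liftD(3)[OF assms(2), of X Y k] *
    by (simp add: distrib_right sum.distrib)
qed (use first_order_liftD[OF assms(1)] first_order_liftD[OF assms(2)] in \<open>auto intro!: DERIV_add\<close>)

text \<open>In \<open>G X * (F X - F Y) + F Y * (G X - G Y)\<close> the differences vanish below
  degree \<open>k\<close>, so only the constant terms \<open>g z\<close> and \<open>f z\<close> of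
  the other factors reach degree \<open>k\<close>: the product rule.\<close>

lemma first_order_lift_mult:
  assumes "first_order_lift I z F f d" "first_order_lift I z G g e"
  shows "first_order_lift I z (\<lambda>X. F X * G X) (\<lambda>x. f x * g x) (\<lambda>l. d l * g z + f z * e l)"
  unfolding first_order_lift_def
proof (intro conjI allI ballI impI)
  fix k X Y assume *: "\<forall>l\<in>I. fps_nth (X l) 0 = z l" "\<forall>l\<in>I. fps_nth (Y l) 0 = z l"
    "\<forall>l\<in>I. \<forall>j<k. fps_nth (X l) j = fps_nth (Y l) j"
  have low: "fps_nth (F X - F Y) j = 0" "fps_nth (G X - G Y) j = 0" if "j < k" for j
    using first_order_liftD(2)[OF assms(1), of X Y k j] first_order_liftD(2)[OF assms(2), of X Y k j] * that
    by auto
  have split: "F X * G X - F Y * G Y = G X * (F X - F Y) + F Y * (G X - G Y)"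
    by (simp add: algebra_simps)
  have diff: "fps_nth (F X * G X) j - fps_nth (F Y * G Y) j =
      g z * fps_nth (F X - F Y) j + f z * fps_nth (G X - G Y) j" if "j \<le> k" for j
  proof -
    have "fps_nth (F X * G X) j - fps_nth (F Y * G Y) j = fps_nth (F X * G X - F Y * G Y) j"
      by simp
    also have "\<dots> = fps_nth (G X) 0 * fps_nth (F X - F Y) j + fps_nth (F Y) 0 * fps_nth (G X - G Y) j"
      unfolding split fps_add_nth using low that by (subst (1 2) fps_mult_nth_low) auto
    also have "fps_nth (G X) 0 = g z" by (rule first_order_liftD(1)[OF assms(2)]) (use * in auto)
    also have "fps_nth (F Y) 0 = f z" by (rule first_order_liftD(1)[OF assms(1)]) (use * in auto)
    finally show ?thesis .
  qed
  show "fps_nth (F X * G X) j = fps_nth (F Y * G Y) j" if "j < k" for j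
    using diff[of j] low[OF that] that by simp
  show "fps_nth (F X * G X) k - fps_nth (F Y * G Y) k =
      (\<Sum>l\<in>I. (d l * g z + f z * e l) * (fps_nth (X l) k - fps_nth (Y l) k))"
    unfolding diff[OF order_refl] fps_sub_nth
    using first_order_liftD(3)[OF assms(1), of X Y k] first_order_liftD(3)[OF assms(2), of X Y k] *
    by (simp add: distrib_left distrib_right sum.distrib sum_distrib_left ac_simps)
next
  fix l assume "l \<in> I"
  from DERIV_mult'[OF first_order_liftD(4)[OF assms(1) this] first_order_liftD(4)[OF assms(2) this]]
  show "((\<lambda>t. f (z(l := t)) * g (z(l := t))) has_real_derivative d l * g z + f z * e l) (at (z l))"
    by (simp add: ac_simps)
qed (use first_order_liftD(1)[OF assms(1)] first_order_liftD(1)[OF assms(2)] in auto)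

lemma first_order_lift_power:
  assumes "first_order_lift I z F f d"
  shows "\<exists>e. first_order_lift I z (\<lambda>X. F X ^ n) (\<lambda>x. f x ^ n) e"
proof (induction n)
  case 0
  show ?case using first_order_lift_const[of I z 1] by auto
next
  case (Suc n)
  then show ?case using first_order_lift_mult[OF assms] by auto
qed

lemma first_order_lift_prod:
  assumes "finite J" "\<And>j. j \<in> J \<Longrightarrow> \<exists>e. first_order_lift I z (F j) (f j) e"
  shows "\<exists>e. first_order_lift I z (\<lambda>X. \<Prod>j\<in>J. F j X) (\<lambda>x. \<Prod>j\<in>J. f j x) e"
  using assms
proof (induction J)
  case empty
  show ?case using first_order_lift_const[of I z 1] by auto
next
  case (insert j J)
  then obtain d e where "first_order_lift I z (F j) (f j) d"
    "first_order_lift I z (\<lambda>X. \<Prod>j\<in>J. F j X) (\<lambda>x. \<Prod>j\<in>J. f j x) e"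
    by blast
  from first_order_lift_mult[OF this] insert show ?case by auto
qed

lemma first_order_lift_sum:
  assumes "finite J" "\<And>j. j \<in> J \<Longrightarrow> \<exists>e. first_order_lift I z (F j) (f j) e"
  shows "\<exists>e. first_order_lift I z (\<lambda>X. \<Sum>j\<in>J. F j X) (\<lambda>x. \<Sum>j\<in>J. f j x) e"
  using assms
proof (induction J)
  case empty
  show ?case using first_order_lift_const[of I z 0] by auto
next
  case (insert j J)
  then obtain d e where "first_order_lift I z (F j) (f j) d"
    "first_order_lift I z (\<lambda>X. \<Sum>j\<in>J. F j X) (\<lambda>x. \<Sum>j\<in>J. f j x) e"
    by blast
  from first_order_lift_add[OF this] insert show ?case by auto
qed

text \<open>The differential may stay existential, since uniqueness of derivatives identifies it
  with the partial derivatives in \<open>poly_funs_first_order_lift\<close>.\<close>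

lemma first_order_lift_poly:
  assumes I: "finite I"
  shows "\<exists>e. first_order_lift I z (\<lambda>X. \<Sum>a\<in>exps I d. fps_const (c a) * monom_eval I a X)
    (\<lambda>x. \<Sum>a\<in>exps I d. c a * monom_eval I a x) e"
proof (rule first_order_lift_sum[OF finite_exps[OF I]])
  fix a
  have "\<exists>e. first_order_lift I z (\<lambda>X. \<Prod>k\<in>I. X k ^ a k) (\<lambda>x. \<Prod>k\<in>I. x k ^ a k) e"
    by (rule first_order_lift_prod[OF I first_order_lift_power[OF first_order_lift_var[OF I]]])
  then obtain e where "first_order_lift I z (\<lambda>X. monom_eval I a X) (\<lambda>x. monom_eval I a x) e"
    unfolding monom_eval_def by blast
  from first_order_lift_mult[OF first_order_lift_const this]
  show "\<exists>e. first_order_lift I z (\<lambda>X. fps_const (c a) * monom_eval I a X) (\<lambda>x. c a * monom_eval I a x) e"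
    by blast
qed

text \<open>A change of the argument in degree \<open>k + 1\<close> changes \<open>F s\<close> there
  by the differential, while \<open>fps_X * G s\<close> sees only coefficients up to
  \<open>k\<close>. Solvability of the linearised system thus allows the next coefficient to be
  corrected for all \<open>s\<close> at once.\<close>

lemma hensel:
  assumes F: "\<And>s. s \<in> I \<Longrightarrow> first_order_lift I z (F s) (f s) (d s)"
    and G: "\<And>s. s \<in> I \<Longrightarrow> first_order_lift I z (G s) (g s) (e s)"
    and zero: "\<And>s. s \<in> I \<Longrightarrow> f s z = 0"
    and solve: "\<And>w. \<exists>h. \<forall>s\<in>I. (\<Sum>l\<in>I. d s l * h l) = w s"
  shows "\<exists>X. (\<forall>l\<in>I. fps_nth (X l) 0 = z l) \<and> (\<forall>s\<in>I. F s X + fps_X * G s X = 0)"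
proof -
  define H where "H = (\<lambda>s X. F s X + fps_X * G s X)"
  define P where "P = (\<lambda>k X. (\<forall>l\<in>I. fps_nth (X l) 0 = z l) \<and> (\<forall>s\<in>I. \<forall>j\<le>k. fps_nth (H s X) j = 0))"
  have H_low: "fps_nth (H s X) j = fps_nth (H s Y) j"
    if "s \<in> I" "\<forall>l\<in>I. fps_nth (X l) 0 = z l" "\<forall>l\<in>I. fps_nth (Y l) 0 = z l"
      "\<And>l j. l \<in> I \<Longrightarrow> j < k \<Longrightarrow> fps_nth (X l) j = fps_nth (Y l) j" "j < k" for s X Y j k
    using first_order_liftD(2)[OF F[OF that(1)], of X Y k] first_order_liftD(2)[OF G[OF that(1)], of X Y k] that
    by (cases j) (auto simp: H_def)
  have H_step: "fps_nth (H s X) (Suc k) - fps_nth (H s Y) (Suc k) =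
      (\<Sum>l\<in>I. d s l * (fps_nth (X l) (Suc k) - fps_nth (Y l) (Suc k)))"
    if "s \<in> I" "\<forall>l\<in>I. fps_nth (X l) 0 = z l" "\<forall>l\<in>I. fps_nth (Y l) 0 = z l"
      "\<And>l j. l \<in> I \<Longrightarrow> j < Suc k \<Longrightarrow> fps_nth (X l) j = fps_nth (Y l) j" for s X Y k
    using first_order_liftD(3)[OF F[OF that(1)], of X Y "Suc k"]
      first_order_liftD(2)[OF G[OF that(1)], of X Y "Suc k" k] that
    by (simp add: H_def)
  have "\<exists>Y. \<forall>k. P k (Y k) \<and> (\<forall>l\<in>I. \<forall>j\<le>k. fps_nth (Y (Suc k) l) j = fps_nth (Y k l) j)"
  proof (rule dependent_nat_choice)
    have "fps_nth (F s (\<lambda>l. fps_const (z l))) 0 = f s z" if "s \<in> I" for s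
      by (rule first_order_liftD(1)[OF F[OF that]]) auto
    then show "\<exists>X. P 0 X"
      using zero by (intro exI[of _ "\<lambda>l. fps_const (z l)"]) (auto simp: P_def H_def)
  next
    fix X k assume X: "P k X"
    \<comment> \<open>The Newton correction: adding \<open>h l\<close> in degree
      \<open>k + 1\<close> cancels the error there and leaves the lower degrees untouched.\<close>
    obtain h where h: "\<forall>s\<in>I. (\<Sum>l\<in>I. d s l * h l) = - fps_nth (H s X) (Suc k)"
      using solve[of "\<lambda>s. - fps_nth (H s X) (Suc k)"] by blast
    define Y where "Y = (\<lambda>l. X l + fps_const (h l) * fps_X ^ Suc k)"
    have Y_nth: "fps_nth (Y l) j = fps_nth (X l) j + (if j = Suc k then h l else 0)" for l j
      by (simp add: Y_def fps_X_power_nth del: power_Suc)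
    have base: "\<forall>l\<in>I. fps_nth (X l) 0 = z l" "\<forall>l\<in>I. fps_nth (Y l) 0 = z l"
      using X by (auto simp: P_def Y_nth)
    have "fps_nth (H s Y) j = 0" if s: "s \<in> I" and j: "j \<le> Suc k" for s j
    proof (cases "j = Suc k")
      case True
      then show ?thesis
        using H_step[OF s base(2,1), of k] h s by (simp add: Y_nth)
    next
      case False
      then show ?thesis
        using H_low[OF s base(2,1), of "Suc k" j] X s j by (simp add: Y_nth P_def)
    qed
    then show "\<exists>Y. P (Suc k) Y \<and> (\<forall>l\<in>I. \<forall>j\<le>k. fps_nth (Y l) j = fps_nth (X l) j)"
      using base by (intro exI[of _ Y]) (auto simp: P_def Y_nth)
  qed
  then obtain Y where P: "\<And>k. P k (Y k)"
    and Y: "\<And>k l j. l \<in> I \<Longrightarrow> j \<le> k \<Longrightarrow> fps_nth (Y (Suc k) l) j = fps_nth (Y k l) j"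
    by blast
  have stable: "fps_nth (Y k l) j = fps_nth (Y j l) j" if "l \<in> I" "j \<le> k" for k l j
    using that(2) by (induction k rule: dec_induct) (auto simp: Y that(1))
  \<comment> \<open>The limit of the approximations: coefficient \<open>j\<close> no longer changes
    from \<open>Y j\<close> onwards.\<close>
  define X where "X = (\<lambda>l. Abs_fps (\<lambda>j. fps_nth (Y j l) j))"
  have base: "\<forall>l\<in>I. fps_nth (X l) 0 = z l" "\<forall>l\<in>I. fps_nth (Y k l) 0 = z l" for k
    using P by (auto simp: X_def P_def)
  have "fps_nth (H s X) k = 0" if s: "s \<in> I" for s k
  proof -
    have "fps_nth (X l) j = fps_nth (Y k l) j" if "l \<in> I" "j < Suc k" for l j
      using stable[of l j k] that by (simp add: X_def)
    then have "fps_nth (H s X) k = fps_nth (H s (Y k)) k"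
      by (rule H_low[OF s base]) auto
    then show ?thesis using P[of k] s by (simp add: P_def)
  qed
  then show ?thesis
    using base by (intro exI[of _ X]) (auto simp: fps_eq_iff H_def)
qed

section \<open>The Bezout inequality\<close>

text \<open>Restriction to \<open>I\<close> maps these exponents injectively into a box with
  \<open>d i\<close> choices for each \<open>i\<close>; the degree bound \<open>D\<close> may cut
  off part of the box.\<close>

lemma card_reduced_exps:
  assumes "finite I"
  shows "card {a \<in> exps I D. \<forall>i\<in>I. a i < d i} \<le> (\<Prod>i\<in>I. d i)"
proof -
  have "card {a \<in> exps I D. \<forall>i\<in>I. a i < d i} \<le> card (PiE I (\<lambda>i. {..<d i}))"
  proof (rule card_inj_on_le)
    show "inj_on (\<lambda>a. restrict a I) {a \<in> exps I D. \<forall>i\<in>I. a i < d i}"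
    proof (rule inj_onI, rule ext)
      fix a b :: "'a \<Rightarrow> nat" and k
      assume eq: "restrict a I = restrict b I"
      assume "a \<in> {a \<in> exps I D. \<forall>i\<in>I. a i < d i}" "b \<in> {a \<in> exps I D. \<forall>i\<in>I. a i < d i}"
      moreover have "restrict a I k = restrict b I k"
        by (rule fun_cong[OF eq])
      ultimately show "a k = b k"
        by (cases "k \<in> I") (auto simp: exps_def)
    qed
  qed (use assms in \<open>auto intro: finite_PiE\<close>)
  also have "\<dots> = (\<Prod>i\<in>I. d i)"
    using assms by (simp add: card_PiE)
  finally show ?thesis .
qed

lemma poly_funs_first_order_lift:
  assumes "finite I" "\<And>x. f x = (\<Sum>a\<in>exps I d. c a * monom_eval I a x)"
  shows "first_order_lift I z (\<lambda>X. \<Sum>a\<in>exps I d. fps_const (c a) * monom_eval I a X) f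
    (\<lambda>l. if l \<in> I then deriv (\<lambda>t. f (z(l := t))) (z l) else 0)"
proof -
  have f: "f = (\<lambda>x. \<Sum>a\<in>exps I d. c a * monom_eval I a x)"
    using assms(2) by auto
  obtain e where e: "first_order_lift I z (\<lambda>X. \<Sum>a\<in>exps I d. fps_const (c a) * monom_eval I a X) f e"
    using first_order_lift_poly[OF assms(1)] unfolding f by blast
  have "deriv (\<lambda>t. f (z(l := t))) (z l) = e l" if "l \<in> I" for l
    by (rule DERIV_imp_deriv[OF first_order_liftD(4)[OF e that]])
  then show ?thesis
    by (intro first_order_lift_cong[OF e]) auto
qed

lemma poly_funs_has_partial_derivative:
  assumes "finite I" "f \<in> poly_funs I d" "l \<in> I"
  shows "((\<lambda>t. f (z(l := t))) has_real_derivative deriv (\<lambda>t. f (z(l := t))) (z l)) (at (z l))"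
proof -
  obtain c where "\<And>x. f x = (\<Sum>a\<in>exps I d. c a * monom_eval I a x)"
    using assms(2) by (auto simp: poly_funs_def)
  from first_order_liftD(4)[OF poly_funs_first_order_lift[OF assms(1) this] assms(3)] assms(3)
  show ?thesis by simp
qed

text \<open>Nondegeneracy is stated as solvability of the linearised system, the form used by
  \<open>hensel\<close>. \<open>Z\<close> is any finite set of such zeros, so the bound can also
  serve to prove that the set of all of them is finite.\<close>

theorem bezout_nondegenerate:
  fixes f :: "'i \<Rightarrow> ('i \<Rightarrow> real) \<Rightarrow> real" and Z :: "('i \<Rightarrow> real) set"
  assumes I: "finite I" and Z: "finite Z"
    and distinct: "\<And>z w. z \<in> Z \<Longrightarrow> w \<in> Z \<Longrightarrow> \<forall>l\<in>I. z l = w l \<Longrightarrow> z = w"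
    and poly: "\<And>s. s \<in> I \<Longrightarrow> f s \<in> poly_funs I (d s)"
    and zero: "\<And>z s. z \<in> Z \<Longrightarrow> s \<in> I \<Longrightarrow> f s z = 0"
    and nondeg: "\<And>z w. z \<in> Z \<Longrightarrow>
      \<exists>h. \<forall>s\<in>I. (\<Sum>l\<in>I. deriv (\<lambda>t. f s (z(l := t))) (z l) * h l) = w s"
  shows "card Z \<le> (\<Prod>s\<in>I. d s)"
proof -
  define k where "k = card Z"
  obtain e where e: "bij_betw e {0..<k} Z"
    using ex_bij_betw_nat_finite[OF Z] by (auto simp: k_def)
  have eZ: "e i \<in> Z" if "i < k" for i
    using bij_betw_apply[OF e, of i] that by auto
  have "\<forall>s. \<exists>c. s \<in> I \<longrightarrow> (\<forall>x. f s x = (\<Sum>a\<in>exps I (d s). c a * monom_eval I a x))"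
    using poly by (auto simp: poly_funs_def)
  then obtain c where c: "\<And>s x. s \<in> I \<Longrightarrow> f s x = (\<Sum>a\<in>exps I (d s). c s a * monom_eval I a x)"
    by metis
  define F where "F = (\<lambda>s X. \<Sum>a\<in>exps I (d s). fps_const (c s a) * monom_eval I a X)"
  have "\<exists>X. (\<forall>l\<in>I. fps_nth (X l) 0 = z l) \<and> (\<forall>s\<in>I. F s X + fps_X * X s ^ d s = 0)"
    if z: "z \<in> Z" for z
  proof -
    have "\<exists>e. first_order_lift I z (\<lambda>X. X s ^ d s) (\<lambda>x. x s ^ d s) e" if "s \<in> I" for s
      by (rule first_order_lift_power[OF first_order_lift_var[OF I that]])
    then obtain g where g: "\<And>s. s \<in> I \<Longrightarrow> first_order_lift I z (\<lambda>X. X s ^ d s) (\<lambda>x. x s ^ d s) (g s)"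
      by metis
    show ?thesis
    proof (rule hensel[OF _ g])
      show "first_order_lift I z (F s) (f s)
          (\<lambda>l. if l \<in> I then deriv (\<lambda>t. f s (z(l := t))) (z l) else 0)" if "s \<in> I" for s
        unfolding F_def by (rule poly_funs_first_order_lift[OF I c[OF that]])
      show "\<exists>h. \<forall>s\<in>I. (\<Sum>l\<in>I. (if l \<in> I then deriv (\<lambda>t. f s (z(l := t))) (z l) else 0) * h l) = w s" for w
        using nondeg[OF z, of w] by simp
    qed (use zero z in auto)
  qed
  then have "\<forall>j. \<exists>X. j < k \<longrightarrow> (\<forall>l\<in>I. fps_nth (X l) 0 = e j l) \<and> (\<forall>s\<in>I. F s X + fps_X * X s ^ d s = 0)"
    using eZ by blast
  then obtain X where X0: "\<And>j l. j < k \<Longrightarrow> l \<in> I \<Longrightarrow> fps_nth (X j l) 0 = e j l"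
    and X: "\<And>j. j < k \<Longrightarrow> \<forall>s\<in>I. F s (X j) + fps_X * X j s ^ d s = 0"
    by metis
  \<comment> \<open>Distinct zeros are told apart by a coordinate that depends on the pair.\<close>
  have "\<exists>l. l \<in> I \<and> e i l \<noteq> e i' l" if "i < k" "i' < k" "i \<noteq> i'" for i i'
  proof -
    have "e i \<noteq> e i'"
      using that e by (auto simp: bij_betw_def inj_on_def)
    then show ?thesis
      using distinct[OF eZ[OF that(1)] eZ[OF that(2)]] by blast
  qed
  then obtain l where l: "\<And>i i'. i < k \<Longrightarrow> i' < k \<Longrightarrow> i \<noteq> i' \<Longrightarrow> l i i' \<in> I \<and> e i (l i i') \<noteq> e i' (l i i')"
    by metis
  \<comment> \<open>Unnormalised Lagrange polynomials, applied to power series. Each has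
    \<open>k - 1\<close> factors, so monomials of degree at most \<open>k\<close> suffice and
    \<open>D = k\<close> is taken for \<open>R\<close>.\<close>
  define L where "L = (\<lambda>i x. \<Prod>i'\<in>{0..<k} - {i}. x (l i i') - fps_const (e i' (l i i')))"
  define R where "R = {a \<in> exps I k. \<forall>i\<in>I. a i < d i}"
  from reduced_monomials_span[OF I, where D = k and d = d and c = c]
  obtain \<delta> C where \<delta>: "\<delta> \<noteq> 0"
    and "\<And>X a. \<forall>s\<in>I. F s X + fps_X * X s ^ d s = 0 \<Longrightarrow> a \<in> exps I k \<Longrightarrow>
      \<delta> * monom_eval I a X = (\<Sum>r\<in>R. C a r * monom_eval I r X)"
    unfolding F_def R_def by blast
  with X have C: "\<And>j a. j < k \<Longrightarrow> a \<in> exps I k \<Longrightarrow>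
      \<delta> * monom_eval I a (X j) = (\<Sum>r\<in>R. C a r * monom_eval I r (X j))"
    by blast
  have "\<exists>q. \<forall>x. L i x = (\<Sum>a\<in>exps I k. q a * monom_eval I a x)" if "i < k" for i
  proof -
    have "L i \<in> poly_funs I (card ({0..<k} - {i}))"
      unfolding L_def using l that by (intro poly_funs_prod_linear I) auto
    moreover have "card ({0..<k} - {i}) \<le> k"
      using card_mono[of "{0..<k}" "{0..<k} - {i}"] by simp
    ultimately show ?thesis
      using poly_funs_mono[OF I] unfolding poly_funs_def by blast
  qed
  then obtain q where q: "\<And>i x. i < k \<Longrightarrow> L i x = (\<Sum>a\<in>exps I k. q i a * monom_eval I a x)"
    by metis
  interpret h: comm_ring_hom "\<lambda>f :: real fps. fps_nth f 0"
    by (rule comm_ring_hom_fps_nth_0)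
  \<comment> \<open>At constant terms the lifted zero is \<open>e j\<close>: for
    \<open>j \<noteq> i\<close> the factor with index \<open>j\<close> vanishes, and for
    \<open>j = i\<close> none does.\<close>
  have L0: "fps_nth (L i (X j)) 0 = (\<Prod>i'\<in>{0..<k} - {i}. e j (l i i') - e i' (l i i'))"
    if "i < k" "j < k" for i j
    unfolding L_def h.hom_prod using that l X0 by (intro prod.cong) auto
  have "k \<le> card R"
  proof (rule card_le_of_factorization[where L = "\<lambda>i j. L i (X j)" and \<delta> = \<delta>
        and C = "\<lambda>i r. \<Sum>a\<in>exps I k. q i a * C a r" and E = "\<lambda>r j. monom_eval I r (X j)"])
    show "fps_nth (L i (X i)) 0 \<noteq> 0" if "i < k" for i
      using l that by (auto simp: L0)
    show "fps_nth (L i (X j)) 0 = 0" if "i < k" "j < k" "i \<noteq> j" for i j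
      using that by (auto simp: L0 intro!: bexI[of _ j])
    show "\<delta> * L i (X j) = (\<Sum>r\<in>R. (\<Sum>a\<in>exps I k. q i a * C a r) * monom_eval I r (X j))"
      if "i < k" "j < k" for i j
    proof -
      have "\<delta> * L i (X j) = (\<Sum>a\<in>exps I k. q i a * (\<delta> * monom_eval I a (X j)))"
        using that by (simp add: q sum_distrib_left ac_simps)
      also have "\<dots> = (\<Sum>a\<in>exps I k. q i a * (\<Sum>r\<in>R. C a r * monom_eval I r (X j)))"
        using that by (simp add: C)
      also have "\<dots> = (\<Sum>r\<in>R. (\<Sum>a\<in>exps I k. q i a * C a r) * monom_eval I r (X j))"
        unfolding sum_distrib_left sum_distrib_right
        by (subst sum.swap) (simp add: mult.assoc)
      finally show ?thesis .
    qed
    show "finite R"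
      unfolding R_def using finite_exps[OF I] by auto
  qed (use \<delta> in auto)
  also have "\<dots> \<le> (\<Prod>s\<in>I. d s)"
    unfolding R_def by (rule card_reduced_exps[OF I])
  finally show ?thesis by (simp add: k_def)
qed

section \<open>The averaged function\<close>

lemma finite_avg_index: "finite (avg_index n)"
  by (simp add: avg_index_def)

lemma prod_avg_index: "(\<Prod>s\<in>avg_index n. d s) = d 1 * (\<Prod>s=3..n. d s)"
  by (simp add: avg_index_def)

lemma prod_1_to_n:
  fixes g :: "nat \<Rightarrow> 'a :: comm_monoid_mult"
  assumes "n \<ge> 3"
  shows "(\<Prod>k=1..n. g k) = g 1 * g 2 * (\<Prod>k=3..n. g k)"
proof -
  have "{1..n} = insert 1 (insert 2 {3..n})" using assms by auto
  then show ?thesis by (simp add: mult.assoc)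
qed

lemma sum_1_to_n:
  fixes g :: "nat \<Rightarrow> 'a :: comm_monoid_add"
  assumes "n \<ge> 3"
  shows "(\<Sum>k=1..n. g k) = g 1 + g 2 + (\<Sum>k=3..n. g k)"
proof -
  have "{1..n} = insert 1 (insert 2 {3..n})" using assms by auto
  then show ?thesis by (simp add: add.assoc)
qed

lemma finite_multi_index: "finite (multi_index n m)"
  by (rule finite_subset[OF _ finite_exps[of "{1..n}" m]]) (auto simp: multi_index_def exps_def)

text \<open>
  Substituting \<open>x\<^sub>1 = R cos \<theta>\<close>, \<open>x\<^sub>2 = R sin \<theta>\<close> merges the first two exponents into the one of \<open>R\<close>.
\<close>

definition merge_index :: "nat \<Rightarrow> (nat \<Rightarrow> nat) \<Rightarrow> nat \<Rightarrow> nat" where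
  "merge_index e i = i(1 := e, 2 := 0)"

text \<open>The merged exponent has degree \<open>e + m - (i 1 + i 2)\<close>. The cases of interest
  are \<open>e = i 1 + i 2\<close> with \<open>d = m\<close> and, after a factor \<open>R\<close> is
  split off, \<open>e = i 1 + i 2 - 1\<close> with \<open>d = m - 1\<close>.\<close>

lemma merge_index_in_exps:
  assumes "n \<ge> 3" "i \<in> multi_index n m" "e + m \<le> i 1 + i 2 + d"
  shows "merge_index e i \<in> exps (avg_index n) d"
proof -
  have "sum (merge_index e i) (avg_index n) = e + (\<Sum>k=3..n. i k)"
    by (simp add: avg_index_def merge_index_def)
  then show ?thesis
    using assms sum_1_to_n[OF assms(1), of i]
    by (auto simp: exps_def multi_index_def avg_index_def merge_index_def)
qed

lemma monom_eval_merge_index: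
  "monom_eval (avg_index n) (merge_index e i) x = x 1 ^ e * (\<Prod>k=3..n. x k ^ i k)"
  by (simp add: monom_eval_def avg_index_def merge_index_def)

lemma monomial_at_cylindrical:
  assumes "n \<ge> 3"
  shows "monomial_at n i (cylindrical \<theta> x) = cos \<theta> ^ i 1 * sin \<theta> ^ i 2 *
    monom_eval (avg_index n) (merge_index (i 1 + i 2) i) x"
  unfolding monomial_at_def prod_1_to_n[OF assms] monom_eval_merge_index
  by (simp add: cylindrical_def power_mult_distrib power_add)

text \<open>Integration over the angle affects only the factors \<open>u j\<close>, so it leaves
  constant coefficients on the quantities \<open>v j\<close>.\<close>

lemma integral_affine_combination:
  fixes u :: "'j \<Rightarrow> real \<Rightarrow> real"
  assumes "finite J" "\<And>j. j \<in> J \<Longrightarrow> continuous_on {a..b} (u j)" "a \<le> b"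
  shows "integral {a..b} (\<lambda>t. q * (A + (\<Sum>j\<in>J. u j t * v j))) =
    q * ((b - a) * A + (\<Sum>j\<in>J. integral {a..b} (u j) * v j))"
proof -
  have "((\<lambda>t. \<Sum>j\<in>J. u j t * v j) has_integral (\<Sum>j\<in>J. integral {a..b} (u j) * v j)) {a..b}"
    using assms by (intro has_integral_sum has_integral_mult_left integrable_integral
        integrable_continuous_interval) auto
  from has_integral_mult_right[OF has_integral_add[OF has_integral_const_real this], of q A]
  have "((\<lambda>t. q * (A + (\<Sum>j\<in>J. u j t * v j))) has_integral
      q * ((b - a) * A + (\<Sum>j\<in>J. integral {a..b} (u j) * v j))) {a..b}"
    using assms(3) by simp
  then show ?thesis by (rule integral_unique)
qed

text \<open>Each trigonometric factor integrates to a real coefficient of a monomial in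
  \<open>\<eta>\<close>; \<open>m \<ge> 1\<close> makes room for the linear term.\<close>

lemma averaged_function_poly:
  assumes n: "n \<ge> 3" and "s \<in> avg_index n" "s \<noteq> 1" "m \<ge> 1"
  shows "averaged_function n m a1 b c p s \<in> poly_funs (avg_index n) m"
proof -
  let ?v = "\<lambda>i. monom_eval (avg_index n) (merge_index (i 1 + i 2) i)"
  let ?u = "\<lambda>i \<theta>. p s i * (cos \<theta> ^ i 1 * sin \<theta> ^ i 2)"
  have "averaged_function n m a1 b c p s x =
      1 / b * (2 * pi * c s * monom_eval (avg_index n) (\<lambda>k. if k = s then 1 else 0) x +
        (\<Sum>i\<in>multi_index n m. integral {0..2 * pi} (?u i) * ?v i x))" for x
  proof -
    have "averaged_function n m a1 b c p s x =
        integral {0..2 * pi} (\<lambda>\<theta>. 1 / b * (c s * x s + (\<Sum>i\<in>multi_index n m. ?u i \<theta> * ?v i x)))"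
      using assms unfolding averaged_function_def first_order_term_def monomial_at_cylindrical[OF n]
      by (simp add: mult.assoc)
    also have "\<dots> = 1 / b * ((2 * pi - 0) * (c s * x s) +
        (\<Sum>i\<in>multi_index n m. integral {0..2 * pi} (?u i) * ?v i x))"
      by (rule integral_affine_combination) (auto intro!: continuous_intros finite_multi_index)
    finally show ?thesis
      by (simp add: monom_eval_single[OF finite_avg_index assms(2)] mult.assoc)
  qed
  then have "averaged_function n m a1 b c p s = (\<lambda>x.
      1 / b * (2 * pi * c s * monom_eval (avg_index n) (\<lambda>k. if k = s then 1 else 0) x +
        (\<Sum>i\<in>multi_index n m. integral {0..2 * pi} (?u i) * ?v i x)))" by blast
  also have "\<dots> \<in> poly_funs (avg_index n) m"
  proof (intro poly_funs_add poly_funs_cmult poly_funs_sum poly_funs_monom finite_avg_index)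
    show "(\<lambda>k. if k = s then 1 else 0) \<in> exps (avg_index n) m"
      using assms finite_avg_index by (auto simp: exps_def)
    show "merge_index (i 1 + i 2) i \<in> exps (avg_index n) m" if "i \<in> multi_index n m" for i
      by (rule merge_index_in_exps[OF n that]) simp
  qed
  finally show ?thesis .
qed

lemma averaged_function_1_factor:
  assumes n: "n \<ge> 3"
  shows "\<exists>g\<in>poly_funs (avg_index n) (m - 1). \<forall>x. averaged_function n m a1 b c p 1 x = x 1 * g x"
proof -
  let ?v = "\<lambda>i. monom_eval (avg_index n) (merge_index (i 1 + i 2) i)"
  let ?w = "\<lambda>i. monom_eval (avg_index n) (merge_index (i 1 + i 2 - 1) i)"
  let ?u = "\<lambda>i \<theta>. (p 1 i * cos \<theta> + p 2 i * sin \<theta>) * (cos \<theta> ^ i 1 * sin \<theta> ^ i 2)"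
  let ?J = "{i \<in> multi_index n m. i 1 + i 2 > 0}"
  \<comment> \<open>The linear term contributes a constant. In \<open>?w\<close> the exponent of
    \<open>R\<close> is a true difference, because \<open>?J\<close> contains only indices with
    \<open>i 1 + i 2 > 0\<close>.\<close>
  define g where "g = (\<lambda>x. 1 / b * (2 * pi * a1 * monom_eval (avg_index n) (\<lambda>_. 0) x +
    (\<Sum>i\<in>?J. integral {0..2 * pi} (?u i) * ?w i x)))"
  \<comment> \<open>Such a monomial contains no trigonometric factor of its own, and cosine and sine
    have mean zero over a full period.\<close>
  have vanish: "integral {0..2 * pi} (?u i) = 0" if "i 1 + i 2 = 0" for i
  proof -
    have "((\<lambda>\<theta>. p 1 i * cos \<theta> + p 2 i * sin \<theta>) has_integral
        (p 1 i * sin (2 * pi) - p 2 i * cos (2 * pi)) - (p 1 i * sin 0 - p 2 i * cos 0)) {0..2 * pi}"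
      by (rule fundamental_theorem_of_calculus)
        (auto simp flip: has_real_derivative_iff_has_vector_derivative intro!: derivative_eq_intros)
    then show ?thesis using that by (simp add: integral_unique)
  qed
  have "averaged_function n m a1 b c p 1 x = x 1 * g x" for x
  proof -
    have "averaged_function n m a1 b c p 1 x =
        integral {0..2 * pi} (\<lambda>\<theta>. 1 / b * (a1 * x 1 + (\<Sum>i\<in>multi_index n m. ?u i \<theta> * ?v i x)))"
      unfolding averaged_function_def first_order_term_def monomial_at_cylindrical[OF n]
      by (simp add: mult.assoc)
    also have "\<dots> = 1 / b * ((2 * pi - 0) * (a1 * x 1) +
        (\<Sum>i\<in>multi_index n m. integral {0..2 * pi} (?u i) * ?v i x))"
      by (rule integral_affine_combination) (auto intro!: continuous_intros finite_multi_index)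
    also have "(\<Sum>i\<in>multi_index n m. integral {0..2 * pi} (?u i) * ?v i x) =
        (\<Sum>i\<in>?J. integral {0..2 * pi} (?u i) * ?v i x)"
      using vanish by (intro sum.mono_neutral_right finite_multi_index) auto
    also have "\<dots> = (\<Sum>i\<in>?J. x 1 * (integral {0..2 * pi} (?u i) * ?w i x))"
    proof (rule sum.cong)
      fix i assume "i \<in> ?J"
      then have "x 1 ^ (i 1 + i 2) = x 1 * x 1 ^ (i 1 + i 2 - 1)"
        by (simp flip: power_Suc)
      then have "?v i x = x 1 * ?w i x"
        unfolding monom_eval_merge_index by (simp only: mult.assoc)
      then show "integral {0..2 * pi} (?u i) * ?v i x = x 1 * (integral {0..2 * pi} (?u i) * ?w i x)"
        by (simp only: mult.left_commute)
    qed simp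
    finally show ?thesis
      by (simp add: g_def monom_eval_def sum_distrib_left[symmetric] distrib_left mult.left_commute)
  qed
  moreover have "g \<in> poly_funs (avg_index n) (m - 1)"
    unfolding g_def
  proof (intro poly_funs_add poly_funs_cmult poly_funs_sum poly_funs_monom finite_avg_index)
    show "(\<lambda>_. 0) \<in> exps (avg_index n) (m - 1)"
      by (simp add: exps_def)
    show "merge_index (i 1 + i 2 - 1) i \<in> exps (avg_index n) (m - 1)" if "i \<in> ?J" for i
      using that by (intro merge_index_in_exps[OF n, of _ m]) auto
  qed
  ultimately show ?thesis by blast
qed

section \<open>The Jacobian matrix and the count of simple zeros\<close>

lemma bij_avg_pos:
  assumes "n \<ge> 3"
  shows "bij_betw avg_pos {0..<n - 1} (avg_index n)"
proof -
  have "avg_index n \<subseteq> avg_pos ` {0..<n - 1}"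
  proof
    fix s assume "s \<in> avg_index n"
    then show "s \<in> avg_pos ` {0..<n - 1}"
      using assms by (auto simp: avg_index_def avg_pos_def intro: image_eqI[of _ _ 0] image_eqI[of _ _ "s - 2"])
  qed
  then show ?thesis
    using assms by (auto simp: bij_betw_def inj_on_def avg_index_def avg_pos_def)
qed

text \<open>The solution is the adjugate applied to \<open>w\<close>, divided by the determinant,
  with matrix positions translated into variable indices by \<open>avg_pos\<close>.\<close>

lemma jacobian_solvable:
  assumes n: "n \<ge> 3" and det: "Determinant.det (jacobian_matrix n f \<eta>) \<noteq> 0"
  shows "\<exists>h. \<forall>s\<in>avg_index n.
    (\<Sum>l\<in>avg_index n. deriv (\<lambda>t. f s (\<eta>(l := t))) (\<eta> l) * h l) = w s"
proof -
  define J where "J = jacobian_matrix n f \<eta>"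
  define \<delta> where "\<delta> = Determinant.det J"
  define N where "N = adj_mat J"
  let ?k = "n - 1"
  have J: "J \<in> carrier_mat ?k ?k" by (simp add: J_def jacobian_matrix_def)
  have N: "N \<in> carrier_mat ?k ?k" and JN: "J * N = \<delta> \<cdot>\<^sub>m 1\<^sub>m ?k"
    using adj_mat[OF J] by (auto simp: N_def \<delta>_def)
  have entry: "(\<Sum>l=0..<?k. J $$ (i, l) * N $$ (l, j)) = (if i = j then \<delta> else 0)"
    if "i < ?k" "j < ?k" for i j
  proof -
    have "(J * N) $$ (i, j) = (\<Sum>l=0..<?k. J $$ (i, l) * N $$ (l, j))"
      using that J N by (auto simp: scalar_prod_def)
    with JN that show ?thesis by auto
  qed
  define g where "g = inv_into {0..<?k} avg_pos"
  have g: "g (avg_pos l) = l" if "l < ?k" for l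
    using that bij_betw_inv_into_left[OF bij_avg_pos[OF n]] by (auto simp: g_def)
  define h where "h = (\<lambda>l. \<Sum>j=0..<?k. N $$ (g l, j) * (w (avg_pos j) / \<delta>))"
  have "(\<Sum>l\<in>avg_index n. deriv (\<lambda>t. f s (\<eta>(l := t))) (\<eta> l) * h l) = w s"
    if s: "s \<in> avg_index n" for s
  proof -
    have "s \<in> avg_pos ` {0..<?k}"
      using s bij_betw_imp_surj_on[OF bij_avg_pos[OF n]] by blast
    then obtain i where i: "i < ?k" "s = avg_pos i" by auto
    have "(\<Sum>l\<in>avg_index n. deriv (\<lambda>t. f s (\<eta>(l := t))) (\<eta> l) * h l) =
        (\<Sum>l=0..<?k. deriv (\<lambda>t. f s (\<eta>(avg_pos l := t))) (\<eta> (avg_pos l)) * h (avg_pos l))"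
      by (rule sum.reindex_bij_betw[OF bij_avg_pos[OF n], symmetric])
    also have "\<dots> = (\<Sum>l=0..<?k. \<Sum>j=0..<?k. J $$ (i, l) * N $$ (l, j) * (w (avg_pos j) / \<delta>))"
      using i by (intro sum.cong) (auto simp: h_def g J_def jacobian_matrix_def sum_distrib_left mult.assoc)
    also have "\<dots> = (\<Sum>j=0..<?k. (\<Sum>l=0..<?k. J $$ (i, l) * N $$ (l, j)) * (w (avg_pos j) / \<delta>))"
      unfolding sum_distrib_right by (rule sum.swap)
    also have "\<dots> = (\<Sum>j=0..<?k. if i = j then w (avg_pos j) else 0)"
      using entry i det by (intro sum.cong) (auto simp: \<delta>_def J_def)
    finally show ?thesis using i by simp
  qed
  then show ?thesis by blast
qed

text \<open>Replacing the first component \<open>R g\<close> by \<open>g\<close> lowers its degree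
  bound to \<open>m - 1\<close>. At zeros with \<open>R > 0\<close> it keeps both the vanishing and
  the nondegeneracy.\<close>

lemma card_simple_zeros_le:
  assumes n: "n \<ge> 3" and m: "m \<ge> 1" and Z: "finite Z"
    and sub: "Z \<subseteq> simple_zeros n (averaged_function n m a1 b c p)"
  shows "card Z \<le> (m - 1) * m ^ (n - 2)"
proof -
  let ?I = "avg_index n" and ?f = "averaged_function n m a1 b c p"
  obtain g where g: "g \<in> poly_funs ?I (m - 1)" and fg: "\<And>x. ?f 1 x = x 1 * g x"
    using averaged_function_1_factor[OF n] by blast
  define F where "F = ?f(1 := g)"
  have zD: "\<eta> k = 0" if "\<eta> \<in> Z" "k \<notin> ?I" for \<eta> k
    using that sub by (auto simp: simple_zeros_def)
  have zR: "\<eta> 1 > 0" and zf: "s \<in> ?I \<Longrightarrow> ?f s \<eta> = 0"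
    and zdet: "Determinant.det (jacobian_matrix n ?f \<eta>) \<noteq> 0" if "\<eta> \<in> Z" for \<eta> s
    using that sub by (auto simp: simple_zeros_def)
  have one: "1 \<in> ?I" by (simp add: avg_index_def)
  have zg: "g \<eta> = 0" if "\<eta> \<in> Z" for \<eta>
    using zf[OF that one] zR[OF that] fg by auto
  have zF: "F s \<eta> = 0" if "\<eta> \<in> Z" "s \<in> ?I" for s \<eta>
    using that zg zf by (simp add: F_def)
  \<comment> \<open>By the product rule the derivative of \<open>R g\<close> has a second term,
    which contains \<open>g \<eta> = 0\<close>; so the first row of the Jacobian is \<open>R\<close>
    times the gradient of \<open>g\<close>.\<close>
  have deriv1: "deriv (\<lambda>t. ?f 1 (\<eta>(l := t))) (\<eta> l) = \<eta> 1 * deriv (\<lambda>t. g (\<eta>(l := t))) (\<eta> l)"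
    if "\<eta> \<in> Z" "l \<in> ?I" for \<eta> l
  proof (rule DERIV_imp_deriv)
    have "((\<lambda>t. (\<eta>(l := t)) 1) has_real_derivative (if l = 1 then 1 else 0)) (at (\<eta> l))"
      by (auto intro!: derivative_eq_intros)
    from DERIV_mult'[OF this poly_funs_has_partial_derivative[OF finite_avg_index g that(2), of \<eta>]]
    show "((\<lambda>t. ?f 1 (\<eta>(l := t))) has_real_derivative
        \<eta> 1 * deriv (\<lambda>t. g (\<eta>(l := t))) (\<eta> l)) (at (\<eta> l))"
      using zg[OF that(1)] unfolding fg by simp
  qed
  have "card Z \<le> (\<Prod>s\<in>?I. if s = 1 then m - 1 else m)"
  proof (rule bezout_nondegenerate[where f = F])
    show "z = w" if "z \<in> Z" "w \<in> Z" "\<forall>l\<in>?I. z l = w l" for z w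
      using that zD by (metis ext)
    show "F s \<in> poly_funs ?I (if s = 1 then m - 1 else m)" if "s \<in> ?I" for s
      using that g averaged_function_poly[OF n] m by (auto simp: F_def)
    show "\<exists>h. \<forall>s\<in>?I. (\<Sum>l\<in>?I. deriv (\<lambda>t. F s (\<eta>(l := t))) (\<eta> l) * h l) = w s"
      if \<eta>: "\<eta> \<in> Z" for \<eta> w
    proof -
      \<comment> \<open>The right-hand side for index 1 is scaled by \<open>R\<close> to compensate
        for this factor, which is then cancelled.\<close>
      obtain h where h: "\<And>s. s \<in> ?I \<Longrightarrow>
          (\<Sum>l\<in>?I. deriv (\<lambda>t. ?f s (\<eta>(l := t))) (\<eta> l) * h l) = (w(1 := \<eta> 1 * w 1)) s"
        using jacobian_solvable[OF n zdet[OF \<eta>], of "w(1 := \<eta> 1 * w 1)"] by blast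
      have "\<eta> 1 * (\<Sum>l\<in>?I. deriv (\<lambda>t. g (\<eta>(l := t))) (\<eta> l) * h l) = \<eta> 1 * w 1"
        using h[OF one] deriv1[OF \<eta>] by (simp add: sum_distrib_left mult.assoc)
      then have "(\<Sum>l\<in>?I. deriv (\<lambda>t. g (\<eta>(l := t))) (\<eta> l) * h l) = w 1"
        using zR[OF \<eta>] by simp
      then have "(\<Sum>l\<in>?I. deriv (\<lambda>t. F s (\<eta>(l := t))) (\<eta> l) * h l) = w s" if "s \<in> ?I" for s
        using h[OF that] by (simp add: F_def)
      then show ?thesis by blast
    qed
  qed (use finite_avg_index Z zF in auto)
  also have "\<dots> = (m - 1) * m ^ (n - 2)"
    using n by (simp add: prod_avg_index)
  finally show ?thesis .
qed

theorem theorem6: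
  fixes n m :: nat
  assumes "n \<ge> 3" and "m \<ge> 2"
  shows "H1 n m \<le> enat ((m - 1) * m ^ (n - 2))"
  unfolding H1_def
proof (rule Sup_least, clarify)
  fix a1 b c p
  let ?S = "simple_zeros n (averaged_function n m a1 b c p)"
  have bound: "card Z \<le> (m - 1) * m ^ (n - 2)" if "Z \<subseteq> ?S" "finite Z" for Z
    using card_simple_zeros_le[OF assms(1) _ that(2,1)] assms(2) by simp
  \<comment> \<open>A common bound on all finite subsets rules out the infinite case, in which
    \<open>number_of\<close> would be \<open>\<infinity>\<close>.\<close>
  then have "finite ?S"
    using finite_if_finite_subsets_card_bdd[of ?S] by blast
  with bound show "number_of ?S \<le> enat ((m - 1) * m ^ (n - 2))"
    by (auto simp: number_of_def)
qed

end
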